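(* Let $(\mathbb{S},\oplus,\odot,\mathbf{0},\mathbf{1})$ be a commutative semiring, let $d\ge 1$, and let $z=(z_1,z_2,\ldots)$ be an $\mathbb{S}^d$-valued time series that is eventually equal to $\mathbf{0}^d=(\mathbf 0,\dots,\mathbf 0)$. Let $0\le p<r<q\le+\infty$ with $p,r$ integers and $q$ an integer or $+\infty$. Then for every word $w\in A^*$ $$\big\langle \mathrm{ISS}^{\mathbb S}_{p,q}(z),w\big\rangle=\bigoplus_{uv=w}\big\langle \mathrm{ISS}^{\mathbb S}_{p,r}(z),u\big\rangle\odot\big\langle \mathrm{ISS}^{\mathbb S}_{r,q}(z),v\big\rangle,$$ where the sum runs over all pairs of (possibly empty) words $u,v\in A^*$ whose concatenation is $w$. Equivalently, with respect to the concatenation product on $\mathbb S\langle\!\langle A\rangle\!\rangle$, $$\mathrm{ISS}^{\mathbb S}_{p,r}(z)\,\mathrm{ISS}^{\mathbb S}_{r,q}(z)=\mathrm{ISS}^{\mathbb S}_{p,q}(z).$$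
   Context: A commutative semiring $(\mathbb S,\oplus,\odot,\mathbf 0,\mathbf 1)$ consists of two commutative monoids $(\mathbb S,\oplus,\mathbf 0)$ and $(\mathbb S,\odot,\mathbf 1)$ such that $\odot$ distributes over $\oplus$ and $\mathbf 0\odot s=\mathbf 0$ for all $s$. The alphabet $A$ is the set of all non-constant formal commutative monomials $[a_1\cdots a_m]$ ($m\ge1$, $a_i\in\{1,\dots,d\}$). $A^*$ is the free monoid of words over $A$, including the empty word $\mathbf e$. $\mathbb S\langle\!\langle A\rangle\!\rangle$ is the set of all maps $F:A^*\to\mathbb S$, written $w\mapsto\langle F,w\rangle$, with concatenation product $\langle F_1F_2,w\rangle=\bigoplus_{vu=w}\langle F_1,v\rangle\odot\langle F_2,u\rangle$. For $z_j=(z_j^{(1)},\dots,z_j^{(d)})\in\mathbb S^d$ and a letter $a=[a_1\cdots a_m]\in A$ put $z_j^{\odot a}:=z_j^{(a_1)}\odot\cdots\odot z_j^{(a_m)}$. For $0\le s\le t\le+\infty$ the iterated-sums signature $\mathrm{ISS}^{\mathbb S}_{s,t}(z)\in\mathbb S\langle\!\langle A\rangle\!\rangle$ is defined, for $w=w_1\cdots w_k$ with $w_i\in A$, by $$\langle \mathrm{ISS}^{\mathbb S}_{s,t}(z),w\rangle:=\bigoplus_{s<j_1<\cdots<j_k<t+1} z_{j_1}^{\odot w_1}\odot\cdots\odot z_{j_k}^{\odot w_k},$$ with value $\mathbf 1$ on the empty word; an empty sum is $\mathbf 0$. If $t=+\infty$, only finitely many summands differ from $\mathbf 0$, since $z$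 is eventually $\mathbf 0^d$, and the sum is the sum of these. *)

theory Defs
  imports
    "HOL-Library.Multiset"
    "HOL-Library.Extended_Nat"
    "HOL-Analysis.Finite_Cartesian_Product"
begin

(* Commutative semirings are rendered by the sort {comm_semiring_0, comm_monoid_mult}.
   The class comm_semiring_1 would additionally require 0 \<noteq> 1 and so exclude the
   trivial semiring. *)

text \<open>
  The letters are the non-constant commutative monomials in variables indexed by the finite
  type \<open>'d\<close>, which plays the role of the index set \<open>{1, ..., d}\<close>; the monomial
  \<open>[a\<^sub>1 ... a\<^sub>m]\<close> is the multiset of its indices. The free monoid of words is
  \<open>'d letter list\<close>, with \<open>[]\<close> as the empty word.
\<close>

typedef 'd letter = "{M :: 'd multiset. M \<noteq> {#}}"
  morphisms indices letter_of
  by (rule exI[of _ "{#undefined#}"]) simp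

type_synonym ('d, 's) series = "'d letter list \<Rightarrow> 's"

definition series_mult ::
  "('d, 's :: {comm_semiring_0, comm_monoid_mult}) series \<Rightarrow> ('d, 's) series \<Rightarrow> ('d, 's) series"
  (infixl \<open>\<bullet>\<^sub>c\<close> 70)
  where "F \<bullet>\<^sub>c G = (\<lambda>w. \<Sum>(v, u) \<in> {(v, u). v @ u = w}. F v * G u)"

definition letter_power ::
  "'s :: {comm_semiring_0, comm_monoid_mult} ^ 'd \<Rightarrow> 'd letter \<Rightarrow> 's"
  where "letter_power x a = (\<Prod>i \<in># indices a. x $ i)"

definition increasing_times :: "nat \<Rightarrow> enat \<Rightarrow> nat \<Rightarrow> nat list set"
  where "increasing_times s t k =
    {js. length js = k \<and> sorted_wrt (<) js \<and> (\<forall>j \<in> set js. s < j \<and> enat j < t + 1)}"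

text \<open>
  For \<open>t = \<infinity>\<close> the index set is infinite. The library operator \<open>sum'\<close> adds up the summands
  different from \<open>0\<close>, provided that there are only finitely many of them.
  The entry \<open>z 0\<close> never contributes, as all times satisfy \<open>s < j\<close>; the time series
  is \<open>z 1, z 2, ...\<close>.
\<close>

definition ISS ::
  "nat \<Rightarrow> enat \<Rightarrow> (nat \<Rightarrow> 's :: {comm_semiring_0, comm_monoid_mult} ^ 'd) \<Rightarrow> ('d, 's) series"
  where "ISS s t z = (\<lambda>w.
    sum' (\<lambda>js. \<Prod>i < length w. letter_power (z (js ! i)) (w ! i))
      (increasing_times s t (length w)))"

lemma finite_splits: "finite {(v, u). v @ u = (w :: 'a list)}"
proof (rule finite_subset)
  show "{(v, u). v @ u = w} \<subseteq> (\<lambda>n. (take n w, drop n w)) ` {..length w}"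
  proof clarify
    fix v u :: "'a list"
    show "(v, u) \<in> (\<lambda>n. (take n (v @ u), drop n (v @ u))) ` {..length (v @ u)}"
      by (rule image_eqI[of _ _ "length v"]) simp_all
  qed
qed simp

lemma letter_power_zero: "letter_power 0 a = 0"
proof -
  have "indices a \<noteq> {#}" using indices[of a] by simp
  then obtain i M where "indices a = add_mset i M" by (meson multiset_cases)
  then show ?thesis by (simp add: letter_power_def)
qed

lemma ISS_Nil: "ISS s t z [] = 1"
proof -
  have "increasing_times s t 0 = {[]}"
    by (auto simp: increasing_times_def)
  then show ?thesis by (simp add: ISS_def sum.eq_sum)
qed

text \<open>The sum in \<^const>\<open>ISS\<close> is never one to which \<open>sum'\<close> assigns its default value.\<close>

lemma finite_ISS_support:
  fixes z :: "nat \<Rightarrow> 's :: {comm_semiring_0, comm_monoid_mult} ^ 'd"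
  assumes "\<forall>\<^sub>F j in sequentially. z j = 0"
  shows "finite {js \<in> increasing_times s t (length w).
    (\<Prod>i < length w. letter_power (z (js ! i)) (w ! i)) \<noteq> 0}"
proof -
  obtain N where N: "\<And>j. j \<ge> N \<Longrightarrow> z j = 0"
    using assms by (auto simp: eventually_sequentially)
  have prod0: "prod f A = 0" if "finite A" "i \<in> A" "f i = 0"
    for f :: "nat \<Rightarrow> 's" and A i
    using that by (simp add: prod.remove[of A i])
  have "js \<in> {js. set js \<subseteq> {..<N} \<and> length js = length w}"
    if js: "js \<in> increasing_times s t (length w)"
      and nz: "(\<Prod>i < length w. letter_power (z (js ! i)) (w ! i)) \<noteq> 0" for js
  proof -
    have len: "length js = length w" using js by (simp add: increasing_times_def)
    have "js ! i < N" if "i < length w" for i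
    proof (rule ccontr)
      assume "\<not> js ! i < N"
      then have "letter_power (z (js ! i)) (w ! i) = 0" by (simp add: N letter_power_zero)
      with that have "(\<Prod>i < length w. letter_power (z (js ! i)) (w ! i)) = 0"
        by (intro prod0[of _ i]) simp_all
      with nz show False by contradiction
    qed
    then show ?thesis using len by (auto simp: in_set_conv_nth)
  qed
  then show ?thesis
    by (intro finite_subset[OF _ finite_lists_length_eq[of "{..<N}" "length w"]]) auto
qed

end

theory Submission
  imports Defs
begin

text \<open>
  As \<open>z\<close> vanishes from some time \<open>N\<close> on, all sums can be truncated to the finitely many tuples
  of times below \<open>N\<close>. An increasing tuple of times in \<open>(p, q + 1)\<close> is cut in exactly one way into
  a tuple of times at most \<open>r\<close> and a tuple of times above \<open>r\<close>, and cutting the word at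
  the same place factorizes the summand. Distributivity does the rest.
\<close>

definition times_below :: "nat \<Rightarrow> nat \<Rightarrow> enat \<Rightarrow> nat \<Rightarrow> nat list set"
  where "times_below N s t k = {js \<in> increasing_times s t k. set js \<subseteq> {..<N}}"

text \<open>A list product in place of the indexed one in \<open>ISS\<close>: it factorizes over
  \<open>@\<close> by simplification and suits induction on lists.\<close>

definition term_at ::
  "(nat \<Rightarrow> 's :: {comm_semiring_0, comm_monoid_mult} ^ 'd) \<Rightarrow> 'd letter list \<Rightarrow> nat list \<Rightarrow> 's"
  where "term_at z w js = prod_list (map2 (\<lambda>j a. letter_power (z j) a) js w)"

lemma finite_times_below: "finite (times_below N s t k)"
proof (rule finite_subset)
  show "times_below N s t k \<subseteq> {js. set js \<subseteq> {..<N} \<and> length js = k}"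
    by (auto simp: times_below_def increasing_times_def)
qed (simp add: finite_lists_length_eq)

lemma length_times_below: "js \<in> times_below N s t k \<Longrightarrow> length js = k"
  by (simp add: times_below_def increasing_times_def)

lemma term_at_eq_prod:
  "length js = length w \<Longrightarrow>
    term_at z w js = (\<Prod>i < length w. letter_power (z (js ! i)) (w ! i))"
  by (simp add: term_at_def prod.list_conv_set_nth lessThan_atLeast0)

lemma term_at_append:
  "length js = length u \<Longrightarrow> term_at z (u @ v) (js @ ks) = term_at z u js * term_at z v ks"
  by (simp add: term_at_def)

text \<open>Letters are non-constant monomials, so each of them takes the value \<open>0\<close> at
  \<open>z j = 0\<close>, and one such factor annihilates the product.\<close>

lemma term_at_eq_0:
  fixes z :: "nat \<Rightarrow> 's :: {comm_semiring_0, comm_monoid_mult} ^ 'd"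
  assumes "length js = length w" and "j \<in> set js" and "z j = 0"
  shows "term_at z w js = 0"
  using assms
  by (induction js w rule: list_induct2) (auto simp: term_at_def letter_power_zero)

lemma ISS_eq_sum_times_below:
  fixes z :: "nat \<Rightarrow> 's :: {comm_semiring_0, comm_monoid_mult} ^ 'd"
  assumes N: "\<And>j. j \<ge> N \<Longrightarrow> z j = 0"
  shows "ISS s t z w = (\<Sum>js \<in> times_below N s t (length w). term_at z w js)"
proof -
  have "ISS s t z w = sum' (term_at z w) (increasing_times s t (length w))"
    unfolding ISS_def
    by (intro sum.cong') (auto simp: term_at_eq_prod increasing_times_def)
  also have "\<dots> = sum' (term_at z w) (times_below N s t (length w))"
  \<comment> \<open>This rule for \<open>sum'\<close> allows an infinite index set, which occurs for
    \<open>t = \<infinity>\<close>; a discarded tuple contains a time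
    \<open>j \<ge> N\<close>.\<close>
  proof (intro sum.mono_neutral_right' ballI)
    fix js assume "js \<in> increasing_times s t (length w) - times_below N s t (length w)"
    then obtain j where "j \<in> set js" "j \<ge> N" and "length js = length w"
      by (force simp: times_below_def increasing_times_def not_less)
    then show "term_at z w js = 0" by (intro term_at_eq_0 N)
  qed (auto simp: times_below_def)
  also have "\<dots> = sum (term_at z w) (times_below N s t (length w))"
    by (rule sum.eq_sum[OF finite_times_below])
  finally show ?thesis .
qed

text \<open>The time \<open>r\<close> itself thus belongs to the first block; the second one starts
  strictly after \<open>r\<close>, so no time is lost or counted twice.\<close>

lemma less_enat_add_1_iff: "enat j < enat r + 1 \<longleftrightarrow> j \<le> r"
  by (simp add: one_enat_def less_Suc_eq_le)

lemma append_times_below: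
  assumes "p < r" and "enat r < q"
    and a: "a \<in> times_below N p (enat r) m" and b: "b \<in> times_below N r q n"
  shows "a @ b \<in> times_below N p q (m + n)"
proof -
  have "j < k" if "j \<in> set a" "k \<in> set b" for j k
    using a b that by (force simp: times_below_def increasing_times_def less_enat_add_1_iff)
  moreover have "enat j < q + 1" if "j \<in> set a" for j
  proof -
    have "enat j \<le> enat r"
      using a that by (auto simp: times_below_def increasing_times_def less_enat_add_1_iff)
    \<comment> \<open>The strict inequality has to come from here, since \<open>q < q + 1\<close>
      fails for \<open>q = \<infinity>\<close>.\<close>
    also have "\<dots> < q" by fact
    also have "\<dots> \<le> q + 1" by simp
    finally show ?thesis .
  qed
  ultimately show ?thesis
    using a b \<open>p < r\<close>
    by (fastforce simp: times_below_def increasing_times_def sorted_wrt_append)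
qed

text \<open>Yields uniqueness of the cut: both blocks can be recovered from their
  concatenation.\<close>

lemma takeWhile_dropWhile_append:
  assumes "\<And>x. x \<in> set a \<Longrightarrow> P x" and "\<And>x. x \<in> set b \<Longrightarrow> \<not> P x"
  shows "takeWhile P (a @ b) = a" and "dropWhile P (a @ b) = b"
  using assms by (cases b; simp)+

lemma split_times_below:
  fixes r :: nat
  assumes js: "js \<in> times_below N p q k"
  defines "a \<equiv> takeWhile (\<lambda>j. j \<le> r) js" and "b \<equiv> dropWhile (\<lambda>j. j \<le> r) js"
  shows "a \<in> times_below N p (enat r) (length a)" and "b \<in> times_below N r q (length b)"
proof -
  have eq: "js = a @ b" by (simp add: a_def b_def)
  then have sorted: "sorted_wrt (<) a" "sorted_wrt (<) b"
    using js by (auto simp: times_below_def increasing_times_def sorted_wrt_append)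
  have "j \<le> r" if "j \<in> set a" for j
    using set_takeWhileD[of j] that unfolding a_def by fastforce
  then show "a \<in> times_below N p (enat r) (length a)"
    using js sorted eq by (auto simp: times_below_def increasing_times_def less_enat_add_1_iff)
  \<comment> \<open>By itself \<open>dropWhile\<close> only controls the head of \<open>b\<close>;
    sortedness carries the bound to the later entries.\<close>
  have "r < j" if "j \<in> set b" for j
  proof -
    have "r < hd b"
      using that hd_dropWhile[of "\<lambda>j. j \<le> r" js] unfolding b_def by fastforce
    moreover have "hd b \<le> j" using that sorted by (cases b) auto
    ultimately show ?thesis by simp
  qed
  then show "b \<in> times_below N r q (length b)"
    using js sorted eq by (auto simp: times_below_def increasing_times_def)
qed

lemma ISS_Chen:
  fixes z :: "nat \<Rightarrow> 's :: {comm_semiring_0, comm_monoid_mult} ^ 'd"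
  assumes "\<forall>\<^sub>F j in sequentially. z j = 0" and "p < r" and "enat r < q"
  shows "ISS p q z w = (\<Sum>(u, v) \<in> {(u, v). u @ v = w}. ISS p (enat r) z u * ISS r q z v)"
proof -
  obtain N where N: "\<And>j. j \<ge> N \<Longrightarrow> z j = 0"
    using assms(1) by (auto simp: eventually_sequentially)
  define A where "A u = times_below N p (enat r) (length u)" for u :: "'d letter list"
  define B where "B v = times_below N r q (length v)" for v :: "'d letter list"
  let ?S = "{(u, v). u @ v = w}"
  let ?C = "\<lambda>(u, v). A u \<times> B v"
  have small: "j \<le> r" if "a \<in> A u" "j \<in> set a" for a u j
    using that by (auto simp: A_def times_below_def increasing_times_def less_enat_add_1_iff)
  have large: "\<not> j \<le> r" if "b \<in> B v" "j \<in> set b" for b v j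
    using that by (auto simp: B_def times_below_def increasing_times_def)
  have len: "length a = length u" "length b = length v" if "a \<in> A u" "b \<in> B v" for a b u v
    using that by (auto simp: A_def B_def length_times_below)
  let ?a = "takeWhile (\<lambda>j. j \<le> r)" and ?b = "dropWhile (\<lambda>j. j \<le> r)"
  have cut: "?a (a @ b) = a" "?b (a @ b) = b" if "a \<in> A u" "b \<in> B v" for a b u v
    using takeWhile_dropWhile_append[of a "\<lambda>j. j \<le> r" b] small[OF that(1)] large[OF that(2)]
    by auto
  \<comment> \<open>Distributivity turns each product of two finite sums into one sum over pairs of
    time tuples.\<close>
  have "(\<Sum>(u, v) \<in> ?S. ISS p (enat r) z u * ISS r q z v)
      = (\<Sum>x \<in> ?S. \<Sum>(a, b) \<in> ?C x. term_at z (fst x) a * term_at z (snd x) b)"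
    by (auto simp: ISS_eq_sum_times_below[OF N] A_def B_def sum_product sum.cartesian_product
        intro!: sum.cong)
  also have "\<dots> = (\<Sum>(x, a, b) \<in> (SIGMA x:?S. ?C x). term_at z (fst x) a * term_at z (snd x) b)"
    by (subst sum.Sigma[OF finite_splits])
      (auto simp: A_def B_def finite_times_below split_def)
  also have "\<dots> = (\<Sum>js \<in> times_below N p q (length w). term_at z w js)"
  \<comment> \<open>The tuple \<open>js\<close> alone determines the split of \<open>w\<close>: the
    length of \<open>u\<close> is the number of times in \<open>js\<close> that are at most
    \<open>r\<close>.\<close>
  proof (rule sum.reindex_bij_witness[where
        j = "\<lambda>(x, a, b). a @ b" and
        i = "\<lambda>js. let n = length (?a js) in ((take n w, drop n w), ?a js, ?b js)"])
    fix y assume "y \<in> (SIGMA x:?S. ?C x)"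
    then obtain u v a b where y: "y = ((u, v), a, b)" and ab: "a \<in> A u" "b \<in> B v" and w: "w = u @ v"
      by auto
    show "(let n = length (?a (case y of (x, a, b) \<Rightarrow> a @ b)) in
        ((take n w, drop n w), ?a (case y of (x, a, b) \<Rightarrow> a @ b), ?b (case y of (x, a, b) \<Rightarrow> a @ b)))
      = y"
      by (simp add: y w cut[OF ab] len[OF ab])
    show "(case y of (x, a, b) \<Rightarrow> a @ b) \<in> times_below N p q (length w)"
      using append_times_below[OF assms(2,3)] ab by (simp add: y w A_def B_def)
    show "term_at z w (case y of (x, a, b) \<Rightarrow> a @ b)
      = (case y of (x, a, b) \<Rightarrow> term_at z (fst x) a * term_at z (snd x) b)"
      by (simp add: y w term_at_append len[OF ab])
  next
    fix js assume js: "js \<in> times_below N p q (length w)"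
    have "length (?a js) + length (?b js) = length w"
      using length_times_below[OF js] by (metis length_append takeWhile_dropWhile_id)
    \<comment> \<open>\<open>A\<close> and \<open>B\<close> refer to the lengths of the word pieces,
      \<open>split_times_below\<close> to those of the time blocks; these equations match
      them.\<close>
    then have "length (take (length (?a js)) w) = length (?a js)"
      "length (drop (length (?a js)) w) = length (?b js)"
      by auto
    then show "(let n = length (?a js) in ((take n w, drop n w), ?a js, ?b js)) \<in> (SIGMA x:?S. ?C x)"
      using split_times_below[OF js, of r] by (simp add: Let_def A_def B_def del: length_take length_drop)
  qed (simp add: Let_def)
  also have "\<dots> = ISS p q z w" by (rule ISS_eq_sum_times_below[OF N, symmetric])
  finally show ?thesis by (rule sym)
qed

theorem lemma2p10:
  fixes z :: "nat \<Rightarrow> 's :: {comm_semiring_0, comm_monoid_mult} ^ 'd"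
    and p r :: nat and q :: enat
  assumes "\<forall>\<^sub>F j in sequentially. z j = 0"
    and "p < r" and "enat r < q"
  shows "(\<forall>w :: 'd letter list.
            ISS p q z w = (\<Sum>(u, v) \<in> {(u, v). u @ v = w}. ISS p (enat r) z u * ISS r q z v))
         \<and> ISS p (enat r) z \<bullet>\<^sub>c ISS r q z = ISS p q z"
  \<comment> \<open>Read coefficientwise, the identity for \<open>\<bullet>\<^sub>c\<close> is the
    first conjunct.\<close>
  unfolding series_mult_def using ISS_Chen[OF assms] by (auto simp: fun_eq_iff)

end
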